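(* Let $A$ be a complex commutative semi-simple regular unital Banach algebra such that $\Delta(A)$ consists of infinitely many points, and let $\sigma$ be an automorphism of $A$. Then $A \rtimes_{\sigma} \mathbb{Z}$ is prime if and only if the associated system $(\Delta(A), \widetilde{\sigma})$ on the character space, where $\widetilde{\sigma}(\mu) = \mu \circ \sigma^{-1}$ for $\mu \in \Delta(A)$, is topologically transitive.
   Context: $\Delta(A)$ denotes the character space of $A$ (the non-zero complex algebra homomorphisms $A \to \mathbb{C}$) with the Gelfand topology, i.e. the weakest topology making all Gelfand transforms $\widehat{a}$, $\widehat{a}(\mu) = \mu(a)$, $a \in A$, continuous; $\widetilde{\sigma}$ is a homeomorphism of $\Delta(A)$. A commutative Banach algebra $A$ is semi-simple if the Gelfand transform $a \mapsto \widehat{a}$ is injective; it is regular if for every closed $F \subseteq \Delta(A)$ and every $\phi_0 \in \Delta(A) \setminus F$ there is $a \in A$ with $\widehat{a}(\phi) = 0$ for all $\phi \in F$ and $\widehat{a}(\phi_0) \neq 0$. "Automorphism" means algebra automorphism. The crossed product $A \rtimes_{\sigma} \mathbb{Z}$ is the purely algebraic one: the set of functions $f : \mathbb{Z} \to A$ with $f(n) = 0$ for all but finitely many $n$, with pointwise addition and scalar multiplication and multiplication given by twisted convolution $(f*g)(n) = \sum_{k \in \mathbb{Z}} f(k) \cdot \sigma^k(g(n-k))$. The system $(\Delta(A), \widetilde{\sigma})$ is topologically transitive if for any pair of non-empty open sets $U, V$ of $\Delta(A)$ there exists an integer $n$ such that $\widetilde{\sigma}^n(U) \cap V \neq \emptyset$.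 The algebra $A \rtimes_{\sigma} \mathbb{Z}$ is called prime if the intersection of any two non-zero ideals $I, J$ is non-zero, i.e. $I \cap J \neq \{0\}$. Ideals are two-sided. *)

theory Defs
  imports "HOL-Analysis.Analysis" "HOL-Algebra.Ideal" "HOL-Algebra.Module"
begin

section \<open>Complex commutative unital Banach algebras\<close>

text \<open>
  The normalisation \<open>norm 1 = 1\<close> is deliberately not required: the norm is only assumed to be
  complete and submultiplicative (\<open>norm_mult_ineq\<close>). The last axiom says that the real vector
  space structure underlying \<open>banach\<close> is the restriction of the complex one.
\<close>

class complex_comm_banach_algebra_1 = comm_ring_1 + real_normed_algebra + banach +
  fixes scaleC :: "complex \<Rightarrow> 'a \<Rightarrow> 'a"  (infixr \<open>*\<^sub>C\<close> 75)
  assumes scaleC_add_right: "c *\<^sub>C (x + y) = c *\<^sub>C x + c *\<^sub>C y"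
    and scaleC_add_left: "(c + d) *\<^sub>C x = c *\<^sub>C x + d *\<^sub>C x"
    and scaleC_scaleC: "c *\<^sub>C (d *\<^sub>C x) = (c * d) *\<^sub>C x"
    and scaleC_one: "1 *\<^sub>C x = x"
    and mult_scaleC_left: "(c *\<^sub>C x) * y = c *\<^sub>C (x * y)"
    and norm_scaleC: "norm (c *\<^sub>C x) = cmod c * norm x"
    and scaleR_scaleC: "r *\<^sub>R x = complex_of_real r *\<^sub>C x"

instantiation complex :: complex_comm_banach_algebra_1
begin

definition scaleC_complex :: "complex \<Rightarrow> complex \<Rightarrow> complex"
  where "scaleC_complex c x = c * x"

instance
  by standard (auto simp: scaleC_complex_def algebra_simps norm_mult scaleR_conv_of_real)

end

definition algebra_hom ::
    "('a::complex_comm_banach_algebra_1 \<Rightarrow> 'b::complex_comm_banach_algebra_1) \<Rightarrow> bool"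
  where "algebra_hom f \<longleftrightarrow>
    (\<forall>x y. f (x + y) = f x + f y) \<and>
    (\<forall>c x. f (c *\<^sub>C x) = c *\<^sub>C f x) \<and>
    (\<forall>x y. f (x * y) = f x * f y)"

definition algebra_automorphism :: "('a::complex_comm_banach_algebra_1 \<Rightarrow> 'a) \<Rightarrow> bool"
  where "algebra_automorphism f \<longleftrightarrow> algebra_hom f \<and> bij f"


section \<open>Character space and Gelfand transform\<close>

definition character_space :: "('a::complex_comm_banach_algebra_1 \<Rightarrow> complex) set"
  where "character_space = {\<mu>. algebra_hom \<mu> \<and> \<mu> \<noteq> (\<lambda>_. 0)}"

definition gelfand_transform ::
    "'a::complex_comm_banach_algebra_1 \<Rightarrow> ('a \<Rightarrow> complex) \<Rightarrow> complex"
  where "gelfand_transform a = (\<lambda>\<mu>\<in>character_space. \<mu> a)"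

definition gelfand_topology :: "('a::complex_comm_banach_algebra_1 \<Rightarrow> complex) topology"
  where "gelfand_topology = topology_generated_by
    {{\<mu> \<in> character_space. gelfand_transform a \<mu> \<in> U} | a U. open U}"

definition semi_simple :: "'a::complex_comm_banach_algebra_1 itself \<Rightarrow> bool"
  where "semi_simple _ \<longleftrightarrow> inj (gelfand_transform :: 'a \<Rightarrow> _)"

definition regular_algebra :: "'a::complex_comm_banach_algebra_1 itself \<Rightarrow> bool"
  where "regular_algebra _ \<longleftrightarrow>
    (\<forall>F \<phi>\<^sub>0. closedin (gelfand_topology :: ('a \<Rightarrow> complex) topology) F \<longrightarrow>
      \<phi>\<^sub>0 \<in> character_space - F \<longrightarrow>
      (\<exists>a. (\<forall>\<phi>\<in>F. gelfand_transform a \<phi> = 0) \<and> gelfand_transform a \<phi>\<^sub>0 \<noteq> 0))"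


section \<open>Dynamics\<close>

text \<open>
  The \<open>n\<close>-th iterate, \<open>n\<close> an integer, of a map \<open>f\<close> that restricts to a bijection of \<open>S\<close>;
  only its values on \<open>S\<close> are meaningful.
\<close>

definition int_iterate :: "'s set \<Rightarrow> ('s \<Rightarrow> 's) \<Rightarrow> int \<Rightarrow> 's \<Rightarrow> 's"
  where "int_iterate S f n =
    (if 0 \<le> n then f ^^ nat n else inv_into S f ^^ nat (- n))"

definition topologically_transitive :: "'s topology \<Rightarrow> ('s \<Rightarrow> 's) \<Rightarrow> bool"
  where "topologically_transitive X f \<longleftrightarrow>
    (\<forall>U V. openin X U \<and> openin X V \<and> U \<noteq> {} \<and> V \<noteq> {} \<longrightarrow>
      (\<exists>n::int. int_iterate (topspace X) f n ` U \<inter> V \<noteq> {}))"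

definition induced_map ::
    "('a::complex_comm_banach_algebra_1 \<Rightarrow> 'a) \<Rightarrow> ('a \<Rightarrow> complex) \<Rightarrow> ('a \<Rightarrow> complex)"
  where "induced_map \<sigma> \<mu> = \<mu> \<circ> Hilbert_Choice.inv \<sigma>"


section \<open>The algebraic crossed product\<close>

text \<open>
  The sum over all integers in the twisted convolution is written over the support of \<open>f\<close>,
  which is finite for \<open>f\<close> in the carrier.
\<close>

definition crossed_product ::
    "('a::complex_comm_banach_algebra_1 \<Rightarrow> 'a) \<Rightarrow> (complex, int \<Rightarrow> 'a) module"
  where "crossed_product \<sigma> =
    \<lparr> carrier = {f. finite {n. f n \<noteq> 0}},
      mult = (\<lambda>f g n. \<Sum>k | f k \<noteq> 0. f k * int_iterate UNIV \<sigma> k (g (n - k))),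
      one = (\<lambda>n. if n = 0 then 1 else 0),
      zero = (\<lambda>_. 0),
      add = (\<lambda>f g n. f n + g n),
      smult = (\<lambda>c f n. c *\<^sub>C f n) \<rparr>"

text \<open>
  Two-sided ring ideals are closed under scalar multiplication when the algebra has a unit,
  since \<open>c \<odot> f = (c \<odot> \<one>) \<otimes> f\<close>. The predicate \<open>ideal\<close> includes that \<open>R\<close> is a ring; the crossed
  product is one whenever \<open>\<sigma>\<close> is an automorphism.
\<close>

definition prime_algebra :: "('b, 'm) ring_scheme \<Rightarrow> bool"
  where "prime_algebra R \<longleftrightarrow>
    (\<forall>I J. ideal I R \<and> ideal J R \<and> I \<noteq> {\<zero>\<^bsub>R\<^esub>} \<and> J \<noteq> {\<zero>\<^bsub>R\<^esub>} \<longrightarrow> I \<inter> J \<noteq> {\<zero>\<^bsub>R\<^esub>})"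

end

theory Submission
  imports Defs
begin

text \<open>
  The crossed product is graded by the integers, with commutation rule
  \<open>\<delta>\<^sup>i a = \<sigma>\<^sup>i(a) \<delta>\<^sup>i\<close> between the generator \<open>\<delta>\<close> and the coefficients. Through
  the Gelfand transform the coefficients are functions on the character space \<open>X\<close>, and \<open>\<sigma>\<^sup>i\<close>
  acts on them by translation along the homeomorphism \<open>\<phi>(\<mu>) = \<mu> \<circ> \<sigma>\<^sup>-\<^sup>1\<close>:
  \<open>\<sigma>\<^sup>i(a)(\<mu>) = a(\<phi>\<^sup>-\<^sup>i \<mu>)\<close>. Semi-simplicity says that a coefficient vanishing at
  every point of \<open>X\<close> is \<open>0\<close>, and regularity supplies coefficients that separate a point from
  a closed set.

  Primeness gives transitivity (\<open>prime_imp_transitive\<close>) because the elements whose coefficients all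
  vanish on an invariant set of characters form an ideal (\<open>ideal_vanishing_ideal\<close>). If no
  iterate of \<open>\<phi>\<close> carries a point of \<open>U\<close> into \<open>V\<close>, then every orbit avoids \<open>U\<close> or
  avoids \<open>V\<close>. The two invariant sets of characters with orbits avoiding \<open>U\<close>,
  respectively \<open>V\<close>, therefore cover \<open>X\<close>, so the corresponding ideals meet only in \<open>0\<close>,
  while each of them is non-zero by regularity.

  Transitivity gives primeness (\<open>transitive_imp_prime\<close>) because the product of two non-zero ideals
  \<open>I\<close> and \<open>J\<close>, which lies in their intersection, is non-zero. Take \<open>f\<close> in \<open>I\<close> with
  \<open>f p \<noteq> 0\<close> and \<open>g\<close> in \<open>J\<close> with \<open>g q \<noteq> 0\<close>. By transitivity some translate of
  \<open>g q\<close> is non-zero at a point \<open>x\<close> where \<open>f p\<close> is non-zero too; this fixes an exponent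
  \<open>k\<close> such that the coefficient of \<open>f a \<delta>\<^sup>k g\<close> in one degree, evaluated at \<open>x\<close>, has
  the term \<open>f p (x) \<cdot> a(\<phi>\<^sup>-\<^sup>p x) \<cdot> \<dots>\<close> with non-zero outer factors. Its other terms carry factors
  \<open>a(\<phi>\<^sup>-\<^sup>i x)\<close> with \<open>i \<noteq> p\<close> in the support of \<open>f\<close>, and \<open>a\<close> can be chosen to
  vanish at these finitely many points but not at \<open>\<phi>\<^sup>-\<^sup>p x\<close>, as soon as \<open>x\<close> is not fixed by
  any \<open>\<phi>\<^bsup>p-i\<^esup>\<close>. Such an \<open>x\<close> exists in every non-empty open set: in a transitive system
  on an infinite Hausdorff space the points fixed by a given non-trivial iterate have empty interior
  (\<open>not_locally_periodic\<close>, \<open>free_point\<close>).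
\<close>

section \<open>Integer iterates\<close>

lemma int_iterate_0 [simp]: "int_iterate S f 0 x = x"
  by (simp add: int_iterate_def)

lemma int_iterate_succ:
  assumes "bij f"
  shows "int_iterate UNIV f (n + 1) x = f (int_iterate UNIV f n x)"
proof (cases "0 \<le> n")
  case True
  then show ?thesis by (simp add: int_iterate_def nat_add_distrib)
next
  case False
  then obtain j where n: "n = - int (Suc j)"
    by (metis int_cases not_less of_nat_0_le_iff)
  have inv: "f (Hilbert_Choice.inv f y) = y" for y
    using assms by (simp add: bij_is_surj surj_f_inv_f)
  have n1: "n + 1 = - int j" using n by simp
  have "int_iterate UNIV f n x = Hilbert_Choice.inv f ((Hilbert_Choice.inv f ^^ j) x)"
    unfolding int_iterate_def n by (simp add: nat_add_distrib)
  moreover have "int_iterate UNIV f (n + 1) x = (Hilbert_Choice.inv f ^^ j) x"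
    unfolding int_iterate_def n1 by simp
  ultimately show ?thesis
    by (simp only: inv)
qed

lemma int_iterate_add:
  assumes "bij f"
  shows "int_iterate UNIV f (m + n) x = int_iterate UNIV f m (int_iterate UNIV f n x)"
proof (induction m rule: int_induct[where k = 0])
  case base
  show ?case by simp
next
  case (step1 i)
  then show ?case
    using int_iterate_succ[OF assms, of "i + n"] int_iterate_succ[OF assms, of i]
    by (simp add: algebra_simps)
next
  case (step2 i)
  have "f (int_iterate UNIV f (i - 1 + n) x) = f (int_iterate UNIV f (i - 1) (int_iterate UNIV f n x))"
    using int_iterate_succ[OF assms, of "i - 1 + n"] int_iterate_succ[OF assms, of "i - 1"] step2
    by (simp add: algebra_simps)
  then show ?case
    using assms by (meson bij_is_inj injD)
qed

section \<open>Topologically transitive actions of the integers\<close>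

text \<open>
  The action laws are required on the points of \<open>X\<close> only, since each \<open>T n\<close> is a total
  function on a type that may be larger.
\<close>

locale transitive_integer_action =
  fixes X :: "'s topology" and T :: "int \<Rightarrow> 's \<Rightarrow> 's"
  assumes haus: "Hausdorff_space X" and inf: "infinite (topspace X)"
    and cont: "continuous_map X X (T n)"
    and T0: "x \<in> topspace X \<Longrightarrow> T 0 x = x"
    and Tadd: "x \<in> topspace X \<Longrightarrow> T (m + n) x = T m (T n x)"
    and trans: "\<lbrakk>openin X U; openin X V; U \<noteq> {}; V \<noteq> {}\<rbrakk> \<Longrightarrow> \<exists>n. \<exists>x\<in>U. T n x \<in> V"
begin

text \<open>
  On an open set \<open>W\<close> of points fixed by \<open>T i\<close>, all orbits are finite. As the space is
  infinite and Hausdorff, the complement of one such orbit is open and non-empty, and by transitivity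
  \<open>W\<close> contains a point \<open>y\<close> outside the orbit of some \<open>x \<in> W\<close>. The finite orbit of \<open>x\<close> can
  be separated from \<open>y\<close> by open sets, and by periodicity points of \<open>W\<close> near \<open>x\<close> then never
  come near \<open>y\<close>, against transitivity.
\<close>

lemma not_locally_periodic:
  assumes "openin X W" and "W \<noteq> {}" and "i \<noteq> 0"
  obtains x where "x \<in> W" "T i x \<noteq> x"
proof (rule ccontr)
  note * = that
  assume "\<not> thesis"
  then have per: "T i x = x" if "x \<in> W" for x
    using *[OF that] by blast
  have WX: "W \<subseteq> topspace X" using \<open>openin X W\<close> by (rule openin_subset)
  have TX: "T n x \<in> topspace X" if "x \<in> topspace X" for n x
    using cont[of n] that by (auto simp: continuous_map_def)
  define d where "d = \<bar>i\<bar>"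
  have "d > 0" using \<open>i \<noteq> 0\<close> by (simp add: d_def)
  have perd: "T d x = x" if "x \<in> W" for x
  proof (cases "i > 0")
    case True
    then show ?thesis using per that by (simp add: d_def)
  next
    case False
    have "x = T (-i + i) x" using T0 that WX by auto
    also have "\<dots> = T (-i) x" using Tadd[of x "-i" i] per that WX by auto
    finally show ?thesis using False by (simp add: d_def)
  qed
  have perk: "T (int k * d) x = x" if "x \<in> W" for k x
  proof (induction k)
    case (Suc k)
    have "T (int (Suc k) * d) x = T (int k * d) (T d x)"
      using Tadd[of x "int k * d" d] that WX by (auto simp: algebra_simps)
    then show ?case using Suc perd that by simp
  qed (use T0 that WX in auto)
  have perkz: "T (k * d) x = x" if "x \<in> W" for k x
  proof (cases "k \<ge> 0")
    case True
    then show ?thesis using perk[OF that, of "nat k"] by simp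
  next
    case False
    then have "k * d + int (nat (- k)) * d = 0" by simp
    then have "x = T (k * d + int (nat (- k)) * d) x" using T0 that WX by auto
    also have "\<dots> = T (k * d) (T (int (nat (- k)) * d) x)" using Tadd that WX by blast
    also have "\<dots> = T (k * d) x" by (simp only: perk[OF that])
    finally show ?thesis ..
  qed
  have mod: "T n x = T (n mod d) x" if "x \<in> W" for n x
    using Tadd[of x "n mod d" "n div d * d"] perkz that WX by auto
  obtain x where x: "x \<in> W" using \<open>W \<noteq> {}\<close> by auto
  define orb where "orb = (\<lambda>n. T n x) ` {0..<d}"
  have orb: "T n x \<in> orb" for n
    using mod[OF x, of n] \<open>d > 0\<close> by (auto simp: orb_def)
  have orbX: "orb \<subseteq> topspace X" using TX x WX by (auto simp: orb_def)
  have "finite orb" by (simp add: orb_def)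
  then have "openin X (topspace X - orb)"
    using haus orbX by (simp add: closedin_Hausdorff_finite openin_diff)
  moreover have "topspace X - orb \<noteq> {}"
    using inf \<open>finite orb\<close> by (metis Diff_eq_empty_iff finite_subset)
  ultimately obtain n y where y: "y \<in> W" and ny: "T n y \<notin> orb"
    using trans[OF \<open>openin X W\<close> _ \<open>W \<noteq> {}\<close>] by blast
  have neq: "T m x \<noteq> y" for m
  proof
    assume "T m x = y"
    then have "T n y = T (n + m) x" using Tadd[of x n m] x WX by auto
    then show False using ny orb by simp
  qed
  have "\<exists>A B. openin X A \<and> openin X B \<and> T m x \<in> A \<and> y \<in> B \<and> disjnt A B" for m
  proof -
    have "T m x \<in> topspace X" "y \<in> topspace X" using TX x y WX by auto
    then show ?thesis using haus neq[of m] unfolding Hausdorff_space_def by auto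
  qed
  then have "\<forall>m. \<exists>A B. openin X A \<and> openin X B \<and> T m x \<in> A \<and> y \<in> B \<and> disjnt A B"
    by (rule allI)
  then have "\<exists>A B. \<forall>m. openin X (A m) \<and> openin X (B m) \<and> T m x \<in> A m
      \<and> y \<in> B m \<and> disjnt (A m) (B m)"
    by (simp only: choice_iff)
  then obtain A B where AB: "\<And>m. openin X (A m)" "\<And>m. openin X (B m)"
      "\<And>m. T m x \<in> A m" "\<And>m. y \<in> B m" "\<And>m. disjnt (A m) (B m)"
    by auto
  \<comment> \<open>Starting in \<open>U\<close>, the first \<open>d\<close> iterates, hence by periodicity all of them, stay in
    the sets \<open>A m\<close> and so outside \<open>V\<close>.\<close>
  define U where "U = W \<inter> (\<Inter>m\<in>{0..<d}. {z \<in> topspace X. T m z \<in> A m})"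
  define V where "V = (\<Inter>m\<in>{0..<d}. B m)"
  have ne: "{0..<d} \<noteq> {}" using \<open>d > 0\<close> by auto
  have "openin X {z \<in> topspace X. T m z \<in> A m}" for m
    by (rule openin_continuous_map_preimage[OF cont AB(1)])
  then have U: "openin X U"
    unfolding U_def by (intro openin_Int \<open>openin X W\<close> openin_INT2 finite_atLeastLessThan_int ne)
  have V: "openin X V"
    unfolding V_def by (intro openin_INT2 AB(2) finite_atLeastLessThan_int ne)
  have "x \<in> U" using x WX AB(3) by (auto simp: U_def)
  moreover have "y \<in> V" using AB(4) by (auto simp: V_def)
  ultimately obtain m z where z: "z \<in> U" and mz: "T m z \<in> V"
    using trans[OF U V] by blast
  have "z \<in> W" using z by (simp add: U_def)
  then have "T m z = T (m mod d) z" by (rule mod)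
  moreover have "m mod d \<in> {0..<d}" using \<open>d > 0\<close> by simp
  ultimately have "T m z \<in> A (m mod d)" "T m z \<in> B (m mod d)"
    using z mz unfolding U_def V_def by auto
  then show False using AB(5)[of "m mod d"] by (auto simp: disjnt_def)
qed

text \<open>
  The points fixed by \<open>T i\<close> form a closed set, so they can be removed from an open set for one
  \<open>i\<close> after the other; by the preceding lemma the set never becomes empty.
\<close>

lemma free_point:
  assumes "openin X W" and "W \<noteq> {}" and "finite N" and "0 \<notin> N"
  obtains x where "x \<in> W" "\<And>i. i \<in> N \<Longrightarrow> T i x \<noteq> x"
proof -
  have "\<exists>x\<in>W. \<forall>i\<in>N. T i x \<noteq> x"
    using \<open>finite N\<close> \<open>0 \<notin> N\<close> \<open>openin X W\<close> \<open>W \<noteq> {}\<close>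
  proof (induction N arbitrary: W)
    case (insert i N)
    define W' where "W' = W - {x \<in> topspace X. T i x = x}"
    have "closedin X {x \<in> topspace X. T i x = x}"
      using closedin_continuous_maps_eq[OF haus cont[of i] continuous_map_id] by simp
    then have "openin X W'" unfolding W'_def by (intro openin_diff insert.prems)
    moreover have "i \<noteq> 0" using insert.prems(1) by auto
    then obtain x where "x \<in> W" "T i x \<noteq> x"
      using not_locally_periodic[OF insert.prems(2,3)] by blast
    then have "W' \<noteq> {}" by (auto simp: W'_def)
    ultimately obtain y where "y \<in> W'" "\<forall>j\<in>N. T j y \<noteq> y"
      using insert by blast
    moreover have "W \<subseteq> topspace X" using insert.prems(2) by (rule openin_subset)
    ultimately show ?case by (auto simp: W'_def)
  qed auto
  then show thesis using that by blast
qed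

end

section \<open>The character space\<close>

lemma character_add: "\<mu> \<in> character_space \<Longrightarrow> \<mu> (x + y) = \<mu> x + \<mu> y"
  and character_mult: "\<mu> \<in> character_space \<Longrightarrow> \<mu> (x * y) = \<mu> x * \<mu> y"
  by (auto simp: character_space_def algebra_hom_def)

lemma character_0: "\<mu> \<in> character_space \<Longrightarrow> \<mu> 0 = 0"
  using character_add[of \<mu> 0 0] by simp

lemma character_uminus: "\<mu> \<in> character_space \<Longrightarrow> \<mu> (- x) = - \<mu> x"
  using character_add[of \<mu> x "- x"] by (simp add: character_0 add_eq_0_iff)

lemma character_sum: "\<mu> \<in> character_space \<Longrightarrow> \<mu> (sum f K) = (\<Sum>k\<in>K. \<mu> (f k))"
  by (induction K rule: infinite_finite_induct) (auto simp: character_0 character_add)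

lemma semi_simple_vanishing:
  fixes a :: "'a::complex_comm_banach_algebra_1"
  assumes "semi_simple TYPE('a)" and "\<And>\<mu>. \<mu> \<in> character_space \<Longrightarrow> \<mu> a = 0"
  shows "a = 0"
proof -
  have "gelfand_transform a = gelfand_transform 0"
    using assms(2) by (auto simp: gelfand_transform_def character_0 fun_eq_iff restrict_def)
  then show ?thesis
    using assms(1) by (auto simp: semi_simple_def dest: injD)
qed

lemma gelfand_subbasis_Union:
  "\<Union> {{\<mu> \<in> character_space. gelfand_transform a \<mu> \<in> U} | a U. open U} = character_space"
    (is "\<Union> ?S = _")
proof
  have "{\<mu> \<in> character_space. gelfand_transform 0 \<mu> \<in> UNIV} \<in> ?S"
    by (rule CollectI, rule exI[of _ 0], rule exI[of _ UNIV]) simp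
  then have "character_space \<in> ?S" by simp
  then show "character_space \<subseteq> \<Union> ?S" by (rule Union_upper)
qed blast

lemma topspace_gelfand_topology [simp]: "topspace gelfand_topology = character_space"
  unfolding gelfand_topology_def topology_generated_by_topspace by (rule gelfand_subbasis_Union)

lemma openin_gelfand_preimage:
  assumes "open U"
  shows "openin gelfand_topology {\<mu> \<in> character_space. \<mu> a \<in> U}"
proof -
  have "{\<mu> \<in> character_space. \<mu> a \<in> U} = {\<mu> \<in> character_space. gelfand_transform a \<mu> \<in> U}"
    by (auto simp: gelfand_transform_def)
  then show ?thesis
    unfolding gelfand_topology_def
    by (simp only:) (rule topology_generated_by_Basis, use assms in blast)
qed

text \<open>
  Two distinct characters differ at some \<open>a\<close>, and \<open>a\<close> pulls disjoint neighbourhoods in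
  the complex plane back to the character space.
\<close>

lemma Hausdorff_gelfand_topology: "Hausdorff_space gelfand_topology"
  unfolding Hausdorff_space_def
proof (intro allI impI)
  fix \<mu> \<nu> :: "'a \<Rightarrow> complex"
  assume *: "\<mu> \<in> topspace gelfand_topology \<and> \<nu> \<in> topspace gelfand_topology \<and> \<mu> \<noteq> \<nu>"
  then obtain a where "\<mu> a \<noteq> \<nu> a" by (auto simp: fun_eq_iff)
  then obtain U V where "open U" "open V" "\<mu> a \<in> U" "\<nu> a \<in> V" "U \<inter> V = {}"
    using hausdorff[of "\<mu> a" "\<nu> a"] by blast
  then have "\<mu> \<in> {\<mu> \<in> character_space. \<mu> a \<in> U}" "\<nu> \<in> {\<mu> \<in> character_space. \<mu> a \<in> V}"
    and "disjnt {\<mu> \<in> character_space. \<mu> a \<in> U} {\<mu> \<in> character_space. \<mu> a \<in> V}"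
    using * by (auto simp: disjnt_def)
  then show "\<exists>U V. openin gelfand_topology U \<and> openin gelfand_topology V \<and>
      \<mu> \<in> U \<and> \<nu> \<in> V \<and> disjnt U V"
    using openin_gelfand_preimage \<open>open U\<close> \<open>open V\<close> by (intro exI conjI)
qed

lemma regular_separation:
  fixes \<phi> :: "'a::complex_comm_banach_algebra_1 \<Rightarrow> complex"
  assumes "regular_algebra TYPE('a)" and "closedin gelfand_topology F"
    and "\<phi> \<in> character_space" and "\<phi> \<notin> F"
  obtains a where "\<And>\<mu>. \<mu> \<in> F \<Longrightarrow> \<mu> a = 0" and "\<phi> a \<noteq> 0"
proof -
  obtain a where a: "\<forall>\<mu>\<in>F. gelfand_transform a \<mu> = 0" "gelfand_transform a \<phi> \<noteq> 0"
    using assms unfolding regular_algebra_def by blast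
  have "F \<subseteq> character_space" using closedin_subset[OF assms(2)] by simp
  with a assms(3) show thesis
    by (intro that[of a]) (auto simp: gelfand_transform_def split: if_splits)
qed

section \<open>The dynamical system of an automorphism\<close>

locale algebra_with_automorphism =
  fixes \<sigma> :: "'a::complex_comm_banach_algebra_1 \<Rightarrow> 'a"
  assumes automorphism: "algebra_automorphism \<sigma>"
begin

abbreviation s :: "int \<Rightarrow> 'a \<Rightarrow> 'a"
  where "s \<equiv> int_iterate UNIV \<sigma>"

lemma bij_\<sigma>: "bij \<sigma>"
  using automorphism by (simp add: algebra_automorphism_def)

lemmas s_add = int_iterate_add[OF bij_\<sigma>]

lemma s_neg_cancel: "s n (s (- n) x) = x"
  using s_add[of n "- n" x] by simp

lemma hom_\<sigma>: "algebra_hom \<sigma>"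
  using automorphism by (simp add: algebra_automorphism_def)

lemma hom_inv_\<sigma>: "algebra_hom (Hilbert_Choice.inv \<sigma>)"
proof -
  have h: "\<sigma> (x + y) = \<sigma> x + \<sigma> y" "\<sigma> (c *\<^sub>C x) = c *\<^sub>C \<sigma> x" "\<sigma> (x * y) = \<sigma> x * \<sigma> y" for c x y
    using hom_\<sigma> by (auto simp: algebra_hom_def)
  have c: "\<sigma> (Hilbert_Choice.inv \<sigma> x) = x" for x
    using bij_\<sigma> by (simp add: bij_is_surj surj_f_inv_f)
  have i: "x = y" if "\<sigma> x = \<sigma> y" for x y
    using that bij_\<sigma> by (meson bij_is_inj injD)
  show ?thesis
    unfolding algebra_hom_def by (intro conjI allI; rule i) (simp_all add: h c)
qed

lemma hom_s: "algebra_hom (s n)"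
proof -
  have "algebra_hom (f ^^ k)" if "algebra_hom f" for f :: "'a \<Rightarrow> 'a" and k
    using that by (induction k) (auto simp: algebra_hom_def)
  then show ?thesis using hom_\<sigma> hom_inv_\<sigma> by (simp add: int_iterate_def)
qed

lemma s_plus: "s n (x + y) = s n x + s n y" and s_times: "s n (x * y) = s n x * s n y"
  using hom_s[of n] by (auto simp: algebra_hom_def)

lemma s_zero [simp]: "s n 0 = 0"
  using s_plus[of n 0 0] by simp

lemma s_sum: "s n (sum f K) = (\<Sum>k\<in>K. s n (f k))"
  by (induction K rule: infinite_finite_induct) (auto simp: s_plus)

lemma s_one [simp]: "s n 1 = 1"
proof -
  have "s n 1 = s n 1 * s n (s (- n) 1)" by (simp add: s_neg_cancel)
  also have "\<dots> = s n (s (- n) 1)" using s_times[of n 1 "s (- n) 1"] by simp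
  finally show ?thesis by (simp add: s_neg_cancel)
qed

text \<open>
  On characters, \<open>T n\<close> is the \<open>n\<close>-th iterate of the induced map. Composing with \<open>\<sigma>\<^sup>-\<^sup>n\<close>
  directly avoids inverses of the induced map and makes the group law hold for all functions.
\<close>

definition T :: "int \<Rightarrow> ('a \<Rightarrow> complex) \<Rightarrow> ('a \<Rightarrow> complex)"
  where "T n \<mu> = \<mu> \<circ> s (- n)"

lemma T_apply: "T n \<mu> a = \<mu> (s (- n) a)"
  by (simp add: T_def)

lemma T_zero: "T 0 \<mu> = \<mu>"
  by (auto simp: T_def)

lemma T_add: "T (m + n) \<mu> = T m (T n \<mu>)"
proof
  fix a
  have "s (- (m + n)) a = s (- n) (s (- m) a)"
    by (simp add: add.commute flip: s_add)
  then show "T (m + n) \<mu> a = T m (T n \<mu>) a" by (simp only: T_apply)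
qed

lemma T_character: "\<mu> \<in> character_space \<Longrightarrow> T n \<mu> \<in> character_space"
proof -
  assume \<mu>: "\<mu> \<in> character_space"
  then obtain a where "\<mu> a \<noteq> 0" by (auto simp: character_space_def)
  then have "T n \<mu> (s n a) \<noteq> 0"
    using s_neg_cancel[of "- n" a] by (simp add: T_apply)
  moreover have "algebra_hom (T n \<mu>)"
    using \<mu> hom_s[of "- n"] by (auto simp: character_space_def algebra_hom_def T_def)
  ultimately show ?thesis by (auto simp: character_space_def)
qed

lemma continuous_T: "continuous_map gelfand_topology gelfand_topology (T n)"
proof -
  have "openin gelfand_topology (T n -` {\<mu> \<in> character_space. gelfand_transform a \<mu> \<in> U}
      \<inter> topspace gelfand_topology)" if "open U" for a and U :: "complex set"
  proof -
    have "T n -` {\<mu> \<in> character_space. gelfand_transform a \<mu> \<in> U} \<inter> topspace gelfand_topology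
        = {\<mu> \<in> character_space. \<mu> (s (- n) a) \<in> U}"
      by (auto simp: gelfand_transform_def T_character T_apply)
    then show ?thesis using openin_gelfand_preimage[OF that] by simp
  qed
  then have "continuous_map gelfand_topology (topology_generated_by
      {{\<mu> \<in> character_space. gelfand_transform a \<mu> \<in> U} | a U. open U}) (T n)"
  proof (intro continuous_on_generated_topo)
    show "T n ` topspace gelfand_topology
        \<subseteq> \<Union> {{\<mu> \<in> character_space. gelfand_transform a \<mu> \<in> U} | a U. open U}"
      unfolding gelfand_subbasis_Union topspace_gelfand_topology using T_character by blast
  qed blast
  then show ?thesis by (simp only: gelfand_topology_def[symmetric])
qed

lemma int_iterate_induced_map:
  assumes "\<mu> \<in> character_space"
  shows "int_iterate character_space (induced_map \<sigma>) n \<mu> = T n \<mu>"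
proof -
  have c: "\<sigma> (Hilbert_Choice.inv \<sigma> x) = x" "Hilbert_Choice.inv \<sigma> (\<sigma> x) = x" for x
    using bij_\<sigma> by (simp_all add: bij_is_surj surj_f_inv_f bij_is_inj)
  have s1: "s 1 = \<sigma>" "s (- 1) = Hilbert_Choice.inv \<sigma>" by (auto simp: int_iterate_def)
  have ind: "induced_map \<sigma> \<nu> = T 1 \<nu>" for \<nu>
    by (simp add: induced_map_def T_def s1)
  have inv: "inv_into character_space (induced_map \<sigma>) \<nu> = T (- 1) \<nu>"
    if "\<nu> \<in> character_space" for \<nu>
  proof (rule inv_into_f_eq)
    show "inj_on (induced_map \<sigma>) character_space"
      using T_add[of "-1" 1] by (intro inj_on_inverseI[of _ "T (- 1)"]) (simp add: ind T_zero)
    show "T (- 1) \<nu> \<in> character_space" using T_character that .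
    show "induced_map \<sigma> (T (- 1) \<nu>) = \<nu>"
      using T_add[of 1 "- 1"] by (simp add: ind T_zero)
  qed
  have pos: "(induced_map \<sigma> ^^ k) \<mu> = T (int k) \<mu>" for k
    by (induction k) (auto simp: T_zero ind simp flip: T_add)
  have neg: "(inv_into character_space (induced_map \<sigma>) ^^ k) \<mu> = T (- int k) \<mu>" for k
    by (induction k) (auto simp: T_zero inv T_character assms simp flip: T_add)
  show ?thesis
    using pos neg[of "nat (- n)"] by (simp add: int_iterate_def)
qed

lemma topologically_transitive_iff:
  "topologically_transitive gelfand_topology (induced_map \<sigma>) \<longleftrightarrow>
    (\<forall>U V. openin gelfand_topology U \<and> openin gelfand_topology V \<and> U \<noteq> {} \<and> V \<noteq> {} \<longrightarrow>
      (\<exists>n. \<exists>\<mu>\<in>U. T n \<mu> \<in> V))"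
  unfolding topologically_transitive_def topspace_gelfand_topology
proof (intro iff_allI imp_cong refl)
  fix U V :: "('a \<Rightarrow> complex) set"
  assume "openin gelfand_topology U \<and> openin gelfand_topology V \<and> U \<noteq> {} \<and> V \<noteq> {}"
  then have "U \<subseteq> character_space"
    using openin_subset[of gelfand_topology U] by simp
  then have "int_iterate character_space (induced_map \<sigma>) n ` U = T n ` U" for n
    by (intro image_cong refl int_iterate_induced_map) auto
  then show "(\<exists>n. int_iterate character_space (induced_map \<sigma>) n ` U \<inter> V \<noteq> {})
      \<longleftrightarrow> (\<exists>n. \<exists>\<mu>\<in>U. T n \<mu> \<in> V)"
    by auto
qed

section \<open>The crossed product is a ring\<close>

abbreviation P :: "(complex, int \<Rightarrow> 'a) module"
  where "P \<equiv> crossed_product \<sigma>"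

lemma carrier_P: "f \<in> carrier P \<longleftrightarrow> finite {n. f n \<noteq> 0}"
  and zero_P: "\<zero>\<^bsub>P\<^esub> = (\<lambda>_. 0)"
  and one_P: "\<one>\<^bsub>P\<^esub> = (\<lambda>n. if n = 0 then 1 else 0)"
  and add_P: "f \<oplus>\<^bsub>P\<^esub> g = (\<lambda>n. f n + g n)"
  by (simp_all add: crossed_product_def)

text \<open>
  Enlarging the index set beyond the support of the left factor lets sums from different products be
  taken over a common finite set.
\<close>

lemma mult_P:
  assumes "finite K" and "\<And>k. f k \<noteq> 0 \<Longrightarrow> k \<in> K"
  shows "(f \<otimes>\<^bsub>P\<^esub> g) n = (\<Sum>k\<in>K. f k * s k (g (n - k)))"
  unfolding crossed_product_def partial_object.simps monoid.simps
proof (rule sum.mono_neutral_left[OF assms(1)])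
  show "{k. f k \<noteq> 0} \<subseteq> K" using assms(2) by blast
qed simp

lemma mult_closed_P:
  assumes f: "f \<in> carrier P" and g: "g \<in> carrier P"
  shows "f \<otimes>\<^bsub>P\<^esub> g \<in> carrier P"
proof -
  let ?K = "{n. f n \<noteq> 0}" and ?L = "{n. g n \<noteq> 0}"
  have fin: "finite ?K" "finite ?L" using f g by (simp_all add: carrier_P)
  have "(f \<otimes>\<^bsub>P\<^esub> g) n = 0" if n: "n \<notin> (\<lambda>(k, l). k + l) ` (?K \<times> ?L)" for n
  proof -
    have "f k * s k (g (n - k)) = 0" if "k \<in> ?K" for k
    proof -
      have "g (n - k) = 0"
      proof (rule ccontr)
        assume "g (n - k) \<noteq> 0"
        then have "(k, n - k) \<in> ?K \<times> ?L" using that by simp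
        then have "(\<lambda>(k, l). k + l) (k, n - k) \<in> (\<lambda>(k, l). k + l) ` (?K \<times> ?L)" by (rule imageI)
        then show False using n by simp
      qed
      then show ?thesis by simp
    qed
    then have "(\<Sum>k\<in>?K. f k * s k (g (n - k))) = 0" by (rule sum.neutral[OF ballI])
    then show ?thesis using mult_P[OF fin(1), of f g n] by simp
  qed
  then have "{n. (f \<otimes>\<^bsub>P\<^esub> g) n \<noteq> 0} \<subseteq> (\<lambda>(k, l). k + l) ` (?K \<times> ?L)" by blast
  then show ?thesis
    unfolding carrier_P by (rule finite_subset) (intro finite_imageI finite_cartesian_product fin)
qed

text \<open>
  Both sides equal \<open>\<Sum>k l. f k \<cdot> \<sigma>\<^sup>k(g l) \<cdot> \<sigma>\<^bsup>k+l\<^esup>(h (n - k - l))\<close>; on the left the outer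
  degree is \<open>m = k + l\<close>, which is the substitution made in the inner sum.
\<close>

lemma mult_assoc_P:
  assumes f: "f \<in> carrier P" and g: "g \<in> carrier P"
  shows "(f \<otimes>\<^bsub>P\<^esub> g) \<otimes>\<^bsub>P\<^esub> h = f \<otimes>\<^bsub>P\<^esub> (g \<otimes>\<^bsub>P\<^esub> h)"
proof
  fix n
  let ?K = "{n. f n \<noteq> 0}" and ?L = "{n. g n \<noteq> 0}"
  \<comment> \<open>All sums of degrees are included even where \<open>f \<otimes> g\<close> vanishes by cancellation: the inner sum
    over \<open>m\<close>, taken for a single \<open>k\<close>, may have non-zero terms there.\<close>
  define M where "M = (\<lambda>(k, l). k + l) ` (?K \<times> ?L) \<union> {n. (f \<otimes>\<^bsub>P\<^esub> g) n \<noteq> 0}"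
  have K: "finite ?K" and L: "finite ?L" using f g by (simp_all add: carrier_P)
  have M: "finite M"
    using K L mult_closed_P[OF f g] by (auto simp: M_def carrier_P)
  have inner: "(\<Sum>m\<in>M. s k (g (m - k)) * s m (h (n - m)))
      = (\<Sum>l\<in>?L. s k (g l) * s (k + l) (h (n - k - l)))" if "k \<in> ?K" for k
  proof -
    have "(\<Sum>l\<in>?L. s k (g l) * s (k + l) (h (n - k - l)))
        = (\<Sum>m\<in>(+) k ` ?L. s k (g (m - k)) * s m (h (n - m)))"
      by (subst sum.reindex) (auto intro!: sum.cong simp: algebra_simps)
    also have "\<dots> = (\<Sum>m\<in>M. s k (g (m - k)) * s m (h (n - m)))"
    proof (intro sum.mono_neutral_left M ballI)
      show "(+) k ` ?L \<subseteq> M"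
      proof
        fix m assume "m \<in> (+) k ` ?L"
        then obtain l where l: "m = k + l" "g l \<noteq> 0" by auto
        then have "(k, l) \<in> ?K \<times> ?L" using that by simp
        then have "(\<lambda>(k, l). k + l) (k, l) \<in> M" unfolding M_def by (intro UnI1 imageI)
        then show "m \<in> M" using l by simp
      qed
      show "s k (g (m - k)) * s m (h (n - m)) = 0" if "m \<in> M - (+) k ` ?L" for m
      proof -
        have "g (m - k) = 0"
        proof (rule ccontr)
          assume "g (m - k) \<noteq> 0"
          then have "k + (m - k) \<in> (+) k ` ?L" by (intro imageI CollectI)
          then show False using that by simp
        qed
        then show ?thesis by simp
      qed
    qed
    finally show ?thesis ..
  qed
  have "((f \<otimes>\<^bsub>P\<^esub> g) \<otimes>\<^bsub>P\<^esub> h) n = (\<Sum>m\<in>M. (f \<otimes>\<^bsub>P\<^esub> g) m * s m (h (n - m)))"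
    using M by (intro mult_P) (auto simp: M_def)
  also have "\<dots> = (\<Sum>m\<in>M. \<Sum>k\<in>?K. f k * (s k (g (m - k)) * s m (h (n - m))))"
    using K by (simp add: mult_P[of ?K f g] sum_distrib_right mult.assoc)
  also have "\<dots> = (\<Sum>k\<in>?K. f k * (\<Sum>m\<in>M. s k (g (m - k)) * s m (h (n - m))))"
    by (subst sum.swap) (simp add: sum_distrib_left)
  also have "\<dots> = (\<Sum>k\<in>?K. f k * (\<Sum>l\<in>?L. s k (g l) * s (k + l) (h (n - k - l))))"
    using inner by simp
  also have "\<dots> = (\<Sum>k\<in>?K. f k * s k ((g \<otimes>\<^bsub>P\<^esub> h) (n - k)))"
    using L by (simp add: mult_P[of ?L g h] s_sum s_times s_add)
  also have "\<dots> = (f \<otimes>\<^bsub>P\<^esub> (g \<otimes>\<^bsub>P\<^esub> h)) n"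
    using K by (intro mult_P[symmetric]) auto
  finally show "((f \<otimes>\<^bsub>P\<^esub> g) \<otimes>\<^bsub>P\<^esub> h) n = (f \<otimes>\<^bsub>P\<^esub> (g \<otimes>\<^bsub>P\<^esub> h)) n" .
qed

lemma add_closed_P:
  assumes "f \<in> carrier P" "g \<in> carrier P"
  shows "f \<oplus>\<^bsub>P\<^esub> g \<in> carrier P"
proof -
  have "{n. f n + g n \<noteq> 0} \<subseteq> {n. f n \<noteq> 0} \<union> {n. g n \<noteq> 0}" by auto
  then show ?thesis
    using assms unfolding carrier_P add_P by (meson finite_UnI finite_subset)
qed

lemma uminus_closed_P: "f \<in> carrier P \<Longrightarrow> (\<lambda>n. - f n) \<in> carrier P"
  by (simp add: carrier_P)

lemma ring_P: "ring P"
proof (rule ringI)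
  show "abelian_group P"
  proof (rule abelian_groupI)
    show "\<exists>g\<in>carrier P. g \<oplus>\<^bsub>P\<^esub> f = \<zero>\<^bsub>P\<^esub>" if "f \<in> carrier P" for f
      by (rule bexI[OF _ uminus_closed_P[OF that]]) (simp add: add_P zero_P)
  qed (auto simp: add_closed_P, auto simp: add_P zero_P carrier_P algebra_simps)
  have one: "\<one>\<^bsub>P\<^esub> \<in> carrier P" by (simp add: one_P carrier_P)
  show "monoid P"
  proof (rule monoidI)
    fix f assume f: "f \<in> carrier P"
    show "\<one>\<^bsub>P\<^esub> \<otimes>\<^bsub>P\<^esub> f = f"
      by (rule ext, subst mult_P[of "{0}"]) (auto simp: one_P split: if_splits)
    show "f \<otimes>\<^bsub>P\<^esub> \<one>\<^bsub>P\<^esub> = f"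
    proof
      fix n
      have "(f \<otimes>\<^bsub>P\<^esub> \<one>\<^bsub>P\<^esub>) n = (\<Sum>k\<in>insert n {k. f k \<noteq> 0}. f k * s k (\<one>\<^bsub>P\<^esub> (n - k)))"
        using f by (intro mult_P) (auto simp: carrier_P)
      also have "\<dots> = (\<Sum>k\<in>insert n {k. f k \<noteq> 0}. if k = n then f n else 0)"
        by (intro sum.cong) (auto simp: one_P)
      also have "\<dots> = f n" using f by (subst sum.delta) (auto simp: carrier_P)
      finally show "(f \<otimes>\<^bsub>P\<^esub> \<one>\<^bsub>P\<^esub>) n = f n" .
    qed
  qed (auto simp: one mult_closed_P mult_assoc_P)
  fix f g h
  assume f: "f \<in> carrier P" and g: "g \<in> carrier P" and h: "h \<in> carrier P"
  let ?K = "{k. f k \<noteq> 0} \<union> {k. g k \<noteq> 0}"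
  have "finite ?K" using f g by (simp add: carrier_P)
  then have K: "(u \<otimes>\<^bsub>P\<^esub> h) n = (\<Sum>k\<in>?K. u k * s k (h (n - k)))"
    if "u \<in> {f, g, f \<oplus>\<^bsub>P\<^esub> g}" for u n
    using that by (intro mult_P) (auto simp: add_P)
  show "(f \<oplus>\<^bsub>P\<^esub> g) \<otimes>\<^bsub>P\<^esub> h = f \<otimes>\<^bsub>P\<^esub> h \<oplus>\<^bsub>P\<^esub> g \<otimes>\<^bsub>P\<^esub> h"
    by (rule ext) (simp add: K add_P[of "f \<otimes>\<^bsub>P\<^esub> h"], simp add: add_P distrib_right sum.distrib)
  have H: "(h \<otimes>\<^bsub>P\<^esub> u) n = (\<Sum>k | h k \<noteq> 0. h k * s k (u (n - k)))" for u n
    using h by (intro mult_P) (auto simp: carrier_P)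
  show "h \<otimes>\<^bsub>P\<^esub> (f \<oplus>\<^bsub>P\<^esub> g) = h \<otimes>\<^bsub>P\<^esub> f \<oplus>\<^bsub>P\<^esub> h \<otimes>\<^bsub>P\<^esub> g"
    by (rule ext)
      (simp add: H add_P[of "h \<otimes>\<^bsub>P\<^esub> f"], simp add: add_P s_plus distrib_left sum.distrib)
qed

section \<open>Ideals and open sets\<close>

text \<open>
  The element \<open>a \<delta>\<^sup>k\<close> of the crossed product.
\<close>

definition single :: "int \<Rightarrow> 'a \<Rightarrow> int \<Rightarrow> 'a"
  where "single k a = (\<lambda>n. if n = k then a else 0)"

lemma single_carrier: "single k a \<in> carrier P"
  by (simp add: single_def carrier_P)

lemma mult_single_P:
  assumes "f \<in> carrier P"
  shows "(f \<otimes>\<^bsub>P\<^esub> single k a) n = f (n - k) * s (n - k) a"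
proof -
  let ?K = "insert (n - k) {i. f i \<noteq> 0}"
  have fin: "finite ?K" using assms by (simp add: carrier_P)
  have "(f \<otimes>\<^bsub>P\<^esub> single k a) n = (\<Sum>i\<in>?K. f i * s i (single k a (n - i)))"
    using fin by (intro mult_P) auto
  also have "\<dots> = (\<Sum>i\<in>?K. if i = n - k then f (n - k) * s (n - k) a else 0)"
    by (intro sum.cong) (auto simp: single_def)
  also have "\<dots> = f (n - k) * s (n - k) a" using fin by (subst sum.delta) auto
  finally show ?thesis .
qed

definition vanishing_ideal :: "('a \<Rightarrow> complex) set \<Rightarrow> (int \<Rightarrow> 'a) set"
  where "vanishing_ideal F = {f \<in> carrier P. \<forall>n. \<forall>\<mu>\<in>F. \<mu> (f n) = 0}"

lemma vanishing_idealD: "\<lbrakk>f \<in> vanishing_ideal F; \<mu> \<in> F\<rbrakk> \<Longrightarrow> \<mu> (f n) = 0"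
  by (auto simp: vanishing_ideal_def)

text \<open>
  Right multiplication multiplies the coefficients of \<open>f\<close> by other elements, which preserves their
  zeros. Left multiplication also translates them by powers of \<open>\<sigma>\<close>; this is where the
  invariance of \<open>F\<close> enters.
\<close>

lemma ideal_vanishing_ideal:
  assumes F: "F \<subseteq> character_space" and inv: "\<And>n \<mu>. \<mu> \<in> F \<Longrightarrow> T n \<mu> \<in> F"
  shows "ideal (vanishing_ideal F) P"
proof (rule idealI[OF ring_P])
  interpret ring P by (rule ring_P)
  have chr: "\<mu> \<in> character_space" if "\<mu> \<in> F" for \<mu> using that F by auto
  show "subgroup (vanishing_ideal F) (add_monoid P)"
  proof (rule add.subgroupI)
    show "vanishing_ideal F \<subseteq> carrier P" by (auto simp: vanishing_ideal_def)
    have "\<zero>\<^bsub>P\<^esub> \<in> vanishing_ideal F"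
      by (auto simp: vanishing_ideal_def chr character_0 zero_P carrier_P)
    then show "vanishing_ideal F \<noteq> {}" by blast
    fix f g assume f: "f \<in> vanishing_ideal F" and g: "g \<in> vanishing_ideal F"
    show "f \<oplus>\<^bsub>P\<^esub> g \<in> vanishing_ideal F"
      unfolding vanishing_ideal_def
    proof (intro CollectI conjI allI ballI add_closed_P)
      fix n \<mu> assume \<mu>: "\<mu> \<in> F"
      show "\<mu> ((f \<oplus>\<^bsub>P\<^esub> g) n) = 0"
        by (simp add: add_P character_add[OF chr[OF \<mu>]]
            vanishing_idealD[OF f \<mu>] vanishing_idealD[OF g \<mu>])
    qed (use f g in \<open>auto simp: vanishing_ideal_def\<close>)
    have fc: "f \<in> carrier P" using f by (simp add: vanishing_ideal_def)
    have "\<ominus>\<^bsub>P\<^esub> f = (\<lambda>n. - f n)"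
      using fc uminus_closed_P[OF fc] by (intro minus_equality) (auto simp: add_P zero_P)
    then show "\<ominus>\<^bsub>P\<^esub> f \<in> vanishing_ideal F"
      using uminus_closed_P[OF fc] vanishing_idealD[OF f]
      by (simp add: vanishing_ideal_def chr character_uminus)
  qed
  fix f h assume f: "f \<in> vanishing_ideal F" and h: "h \<in> carrier P"
  have fc: "f \<in> carrier P" using f by (simp add: vanishing_ideal_def)
  show "h \<otimes>\<^bsub>P\<^esub> f \<in> vanishing_ideal F"
    unfolding vanishing_ideal_def
  proof (intro CollectI conjI allI ballI mult_closed_P h fc)
    fix n \<mu> assume \<mu>: "\<mu> \<in> F"
    have "\<mu> (s k (f m)) = 0" for k m
      using vanishing_idealD[OF f inv[OF \<mu>, of "- k"]] by (simp add: T_apply)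
    moreover have "(h \<otimes>\<^bsub>P\<^esub> f) n = (\<Sum>k | h k \<noteq> 0. h k * s k (f (n - k)))"
      using h by (intro mult_P) (auto simp: carrier_P)
    ultimately show "\<mu> ((h \<otimes>\<^bsub>P\<^esub> f) n) = 0"
      using chr[OF \<mu>] by (simp add: character_sum character_mult)
  qed
  show "f \<otimes>\<^bsub>P\<^esub> h \<in> vanishing_ideal F"
    unfolding vanishing_ideal_def
  proof (intro CollectI conjI allI ballI mult_closed_P h fc)
    fix n \<mu> assume \<mu>: "\<mu> \<in> F"
    have "(f \<otimes>\<^bsub>P\<^esub> h) n = (\<Sum>k | f k \<noteq> 0. f k * s k (h (n - k)))"
      using fc by (intro mult_P) (auto simp: carrier_P)
    then show "\<mu> ((f \<otimes>\<^bsub>P\<^esub> h) n) = 0"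
      by (simp add: character_sum[OF chr[OF \<mu>]] character_mult[OF chr[OF \<mu>]]
          vanishing_idealD[OF f \<mu>])
  qed
qed

text \<open>
  The ideals attached to \<open>U\<close> and \<open>V\<close> consist of the elements whose coefficients vanish on
  the orbits avoiding \<open>U\<close>, respectively \<open>V\<close>. They are non-zero by regularity, and they
  intersect in \<open>0\<close> if no orbit meets both \<open>U\<close> and \<open>V\<close>.
\<close>

lemma prime_imp_transitive:
  assumes ss: "semi_simple TYPE('a)" and reg: "regular_algebra TYPE('a)"
    and prime: "prime_algebra P"
    and U: "openin gelfand_topology U" "U \<noteq> {}" and V: "openin gelfand_topology V" "V \<noteq> {}"
  shows "\<exists>n. \<exists>\<mu>\<in>U. T n \<mu> \<in> V"
proof (rule ccontr)
  assume disj: "\<not> (\<exists>n. \<exists>\<mu>\<in>U. T n \<mu> \<in> V)"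
  define avoiding where "avoiding O' = {\<mu> \<in> character_space. \<forall>n. T n \<mu> \<notin> O'}" for O'
  define I where "I O' = vanishing_ideal (avoiding O')" for O'
  have ideal: "ideal (I O') P" for O'
    unfolding I_def
    by (rule ideal_vanishing_ideal)
      (auto simp: avoiding_def T_character simp flip: T_add)
  have nonzero: "I O' \<noteq> {\<zero>\<^bsub>P\<^esub>}" if O': "openin gelfand_topology O'" "O' \<noteq> {}" for O'
  proof -
    obtain \<phi> where \<phi>: "\<phi> \<in> O'" using O' by auto
    then have "\<phi> \<in> character_space" using openin_subset[OF O'(1)] by auto
    then obtain a where a: "\<And>\<mu>. \<mu> \<in> character_space - O' \<Longrightarrow> \<mu> a = 0" "\<phi> a \<noteq> 0"
      using regular_separation[OF reg, of "character_space - O'" \<phi>] O'(1) \<phi>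
        closedin_topspace[of "gelfand_topology :: ('a \<Rightarrow> complex) topology"]
      by (auto intro: closedin_diff)
    have "avoiding O' \<subseteq> character_space - O'"
    proof
      fix \<mu> assume "\<mu> \<in> avoiding O'"
      then have "\<mu> \<in> character_space" "T 0 \<mu> \<notin> O'" by (auto simp: avoiding_def)
      then show "\<mu> \<in> character_space - O'" by (simp add: T_zero)
    qed
    then have "single 0 a \<in> I O'"
      using a(1) single_carrier
      by (auto simp: I_def vanishing_ideal_def single_def character_0)
    moreover have "a \<noteq> 0" using a(2) \<open>\<phi> \<in> character_space\<close> character_0 by auto
    then have "single 0 a \<noteq> \<zero>\<^bsub>P\<^esub>" by (auto simp: single_def zero_P fun_eq_iff)
    ultimately show ?thesis by blast
  qed
  have "f = \<zero>\<^bsub>P\<^esub>" if f: "f \<in> I U \<inter> I V" for f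
  proof -
    have cover: "\<mu> \<in> avoiding U \<union> avoiding V" if \<mu>: "\<mu> \<in> character_space" for \<mu>
    proof (rule ccontr)
      assume "\<not> ?thesis"
      then obtain m n where "T m \<mu> \<in> U" "T n \<mu> \<in> V"
        using \<mu> by (auto simp: avoiding_def)
      moreover have "T (n - m) (T m \<mu>) = T n \<mu>" by (simp flip: T_add)
      ultimately show False using disj by metis
    qed
    have "f n = 0" for n
    proof (rule semi_simple_vanishing[OF ss])
      fix \<mu> :: "'a \<Rightarrow> complex" assume "\<mu> \<in> character_space"
      then consider "\<mu> \<in> avoiding U" | "\<mu> \<in> avoiding V" using cover by blast
      then show "\<mu> (f n) = 0"
        using f vanishing_idealD unfolding I_def by cases blast+
    qed
    then show ?thesis by (auto simp: zero_P)
  qed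
  moreover have "\<zero>\<^bsub>P\<^esub> \<in> I U \<inter> I V"
    by (simp add: additive_subgroup.zero_closed ideal ideal.axioms(1))
  ultimately have "I U \<inter> I V = {\<zero>\<^bsub>P\<^esub>}" by blast
  then show False
    using prime ideal nonzero U V by (auto simp: prime_algebra_def)
qed

text \<open>
  The witness for \<open>I \<inter> J \<noteq> 0\<close> is \<open>f a \<delta>\<^sup>k g\<close>: in a suitable degree all but one of the terms
  vanish at a point \<open>x\<close> that is free for the finitely many relevant iterates.
\<close>

lemma transitive_imp_prime:
  assumes ss: "semi_simple TYPE('a)" and reg: "regular_algebra TYPE('a)"
    and inf: "infinite (character_space :: ('a \<Rightarrow> complex) set)"
    and trans: "\<And>U V. \<lbrakk>openin gelfand_topology U; openin gelfand_topology V; U \<noteq> {}; V \<noteq> {}\<rbrakk>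
      \<Longrightarrow> \<exists>n. \<exists>\<mu>\<in>U. T n \<mu> \<in> V"
  shows "prime_algebra P"
  unfolding prime_algebra_def
proof (intro allI impI, elim conjE)
  fix I J assume I: "ideal I P" "I \<noteq> {\<zero>\<^bsub>P\<^esub>}" and J: "ideal J P" "J \<noteq> {\<zero>\<^bsub>P\<^esub>}"
  interpret transitive_integer_action gelfand_topology T
  proof
    show "infinite (topspace (gelfand_topology :: ('a \<Rightarrow> complex) topology))" using inf by simp
  qed (rule Hausdorff_gelfand_topology continuous_T T_zero T_add trans; assumption)+
  interpret I: ideal I P by (rule I)
  interpret J: ideal J P by (rule J)
  have nonzero_element: "\<exists>f. f \<in> K \<and> f \<noteq> \<zero>\<^bsub>P\<^esub>" if "ideal K P" "K \<noteq> {\<zero>\<^bsub>P\<^esub>}" for K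
    using that(2) additive_subgroup.zero_closed[OF ideal.axioms(1)[OF that(1)]] by auto
  obtain f where f: "f \<in> I" "f \<noteq> \<zero>\<^bsub>P\<^esub>" using nonzero_element[OF I] by auto
  obtain g where g: "g \<in> J" "g \<noteq> \<zero>\<^bsub>P\<^esub>" using nonzero_element[OF J] by auto
  have fc: "f \<in> carrier P" and gc: "g \<in> carrier P" using I.a_subset J.a_subset f(1) g(1) by blast+
  obtain p q where p: "f p \<noteq> 0" and q: "g q \<noteq> 0"
    using f(2) g(2) unfolding zero_P fun_eq_iff by auto
  let ?D = "\<lambda>a. {\<mu> \<in> character_space. \<mu> a \<in> - {0}}"
  have open_D: "openin gelfand_topology (?D a)" for a :: 'a
    by (rule openin_gelfand_preimage) auto
  have D: "?D a \<noteq> {}" if "a \<noteq> 0" for a :: 'a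
    using semi_simple_vanishing[OF ss, of a] that by auto
  obtain n \<mu> where \<mu>: "\<mu> \<in> ?D (f p)" "T n \<mu> \<in> ?D (g q)"
    using trans[OF open_D open_D D[OF p] D[OF q]] by blast
  \<comment> \<open>\<open>T (- i) x = T (- p) x\<close> is equivalent to \<open>T (p - i) x = x\<close>, so these are the periods to avoid.\<close>
  define N where "N = (\<lambda>i. p - i) ` ({i. f i \<noteq> 0} - {p})"
  have N: "finite N" "0 \<notin> N" using fc by (auto simp: N_def carrier_P)
  have ne: "?D (f p) \<inter> ?D (s (- n) (g q)) \<noteq> {}" using \<mu> by (auto simp: T_apply)
  obtain x where x: "x \<in> ?D (f p) \<inter> ?D (s (- n) (g q))"
    and free: "\<And>i. i \<in> N \<Longrightarrow> T i x \<noteq> x"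
    using free_point[OF openin_Int[OF open_D open_D] ne N] by blast
  have xc: "x \<in> character_space" using x by auto
  define F where "F = (\<lambda>i. T (- i) x) ` ({i. f i \<noteq> 0} - {p})"
  have "closedin gelfand_topology F"
    using Hausdorff_gelfand_topology fc xc
    by (intro closedin_Hausdorff_finite) (auto simp: F_def carrier_P T_character)
  moreover have "T (- p) x \<notin> F"
  proof
    assume "T (- p) x \<in> F"
    then obtain i where i: "f i \<noteq> 0" "i \<noteq> p" "T (- p) x = T (- i) x" by (auto simp: F_def)
    have "T (p - i) x = T p (T (- i) x)" by (simp flip: T_add)
    also have "\<dots> = x" unfolding i(3)[symmetric] by (simp add: T_zero flip: T_add)
    finally show False using free[of "p - i"] i by (auto simp: N_def)
  qed
  ultimately obtain a where a: "\<And>\<nu>. \<nu> \<in> F \<Longrightarrow> \<nu> a = 0" and ap: "T (- p) x a \<noteq> 0"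
    using regular_separation[OF reg _ T_character[OF xc]] by blast
  have a_other: "x (s i a) = 0" if "f i \<noteq> 0" "i \<noteq> p" for i
    using a[of "T (- i) x"] that by (auto simp: F_def T_apply)
  \<comment> \<open>The term of degree \<open>p\<close> in \<open>f\<close> must bring \<open>g q\<close> in translated by \<open>p + k = - n\<close>.
    The total degree to look at is then \<open>p + k + q = q - n\<close>.\<close>
  define k where "k = - n - p"
  define h where "h = f \<otimes>\<^bsub>P\<^esub> single k a"
  define M where "M = (+) k ` {i. f i \<noteq> 0}"
  have h: "h m = f (m - k) * s (m - k) a" for m
    unfolding h_def by (rule mult_single_P[OF fc])
  have fin: "finite M" using fc by (simp add: M_def carrier_P)
  have "(h \<otimes>\<^bsub>P\<^esub> g) (q - n) = (\<Sum>m\<in>M. h m * s m (g (q - n - m)))"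
  proof (rule mult_P[OF fin])
    fix m assume "h m \<noteq> 0"
    then have "f (m - k) \<noteq> 0" by (auto simp: h)
    then have "k + (m - k) \<in> M" unfolding M_def by (intro imageI CollectI)
    then show "m \<in> M" by simp
  qed
  then have "x ((h \<otimes>\<^bsub>P\<^esub> g) (q - n)) =
      (\<Sum>m\<in>M. x (f (m - k)) * x (s (m - k) a) * x (s m (g (q - n - m))))"
    by (simp add: character_sum[OF xc] character_mult[OF xc] h)
  also have "\<dots> = (\<Sum>m\<in>M. if m = - n then x (f p) * x (s p a) * x (s (- n) (g q)) else 0)"
  proof (intro sum.cong refl)
    fix m assume "m \<in> M"
    then obtain i where "m = k + i" "f i \<noteq> 0" by (auto simp: M_def)
    then show "x (f (m - k)) * x (s (m - k) a) * x (s m (g (q - n - m))) =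
        (if m = - n then x (f p) * x (s p a) * x (s (- n) (g q)) else 0)"
      using a_other[of i] by (cases "i = p") (auto simp: k_def)
  qed
  also have "\<dots> = x (f p) * x (s p a) * x (s (- n) (g q))"
    using fin p by (subst sum.delta) (auto simp: M_def image_iff k_def)
  also have "\<dots> \<noteq> 0" using x ap by (auto simp: T_apply)
  finally have "h \<otimes>\<^bsub>P\<^esub> g \<noteq> \<zero>\<^bsub>P\<^esub>" using xc by (auto simp: zero_P character_0)
  moreover have "h \<in> I" unfolding h_def by (rule I.I_r_closed[OF f(1) single_carrier])
  then have "h \<otimes>\<^bsub>P\<^esub> g \<in> I \<inter> J"
    using I.I_r_closed[OF _ gc] J.I_l_closed[OF g(1)] I.a_subset by blast
  ultimately show "I \<inter> J \<noteq> {\<zero>\<^bsub>P\<^esub>}" by blast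
qed

end

theorem theorem7p6:
  fixes \<sigma> :: "'a::complex_comm_banach_algebra_1 \<Rightarrow> 'a"
  assumes "semi_simple TYPE('a)"
    and "regular_algebra TYPE('a)"
    and "infinite (character_space :: ('a \<Rightarrow> complex) set)"
    and "algebra_automorphism \<sigma>"
  shows "prime_algebra (crossed_product \<sigma>) \<longleftrightarrow>
    topologically_transitive (gelfand_topology :: ('a \<Rightarrow> complex) topology) (induced_map \<sigma>)"
proof -
  interpret algebra_with_automorphism \<sigma> by standard (rule assms(4))
  show ?thesis
    unfolding topologically_transitive_iff
    using prime_imp_transitive[OF assms(1,2)] transitive_imp_prime[OF assms(1-3)] by blast
qed

end
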